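(* Let $\mu\in\mathbb{N}$, $\mu\ge1$, let $\alpha,\beta,\gamma,\delta\in\mathbb{R}$, and let $$\Psi^{\mu,1}(\mu,0)=\begin{pmatrix}1+\mu\alpha&\mu\beta\\ \sum_{i=0}^{\mu-1}\gamma(1+\delta)^i&(1+\delta)^\mu\end{pmatrix}.$$ Suppose that $\lambda(\Psi^{\mu,1}(\mu,0))\subseteq B(0,1)$. Then $o=(0,0)$ is a globally asymptotically stable solution of the $(\mu,1)$-asynchronous difference equation with parameters $\alpha,\beta,\gamma,\delta$, i.e., every solution $(x,y)$ of it satisfies $$\lim_{t\to\infty}x(t)=0=\lim_{t\to\infty}y(t).$$
   Context: For $\rho>0$ let $\mathbb{T}_\rho=\{0,\rho,2\rho,\ldots\}$. For $z:\mathbb{T}_\rho\to\mathbb{R}$ and $t\in\mathbb{T}_\rho$ put $\Delta_\rho z(t)=\frac{z(t+\rho)-z(t)}{\rho}$. For real $t\ge 0$ put $t^{*\rho}=\rho\lfloor t/\rho\rfloor=\max\{s\in\mathbb{T}_\rho: s\le t\}$. For $\mu,\nu>0$ and parameters $\alpha,\beta,\gamma,\delta\in\mathbb{R}$, the $(\mu,\nu)$-asynchronous difference equation is $$\Delta_\mu x(t)=\alpha x(t)+\beta y(t^{*\nu})\ \ (t\in\mathbb{T}_\mu),\qquad \Delta_\nu y(t)=\gamma x(t^{*\mu})+\delta y(t)\ \ (t\in\mathbb{T}_\nu).$$ A solution is a pair $(x,y)$ of functions $x:\mathbb{T}_\mu\to\mathbb{R}$, $y:\mathbb{T}_\nu\to\mathbb{R}$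 satisfying both equations. Here $\nu=1$. The limits are taken along $t\in\mathbb{T}_\mu$ for $x$ and along $t\in\mathbb{T}_1=\{0,1,2,\ldots\}$ for $y$. $\lambda(M)$ denotes the set of all (complex) eigenvalues of a matrix $M$, and $B(0,1)$ the open unit disc in $\mathbb{C}$. "Globally asymptotically stable" is used in the sense stated after "i.e." in the claim. *)

theory Defs
  imports
    "Jordan_Normal_Form.Spectral_Radius"
    "HOL-Analysis.Elementary_Metric_Spaces"
begin

definition time_scale :: "real \<Rightarrow> real set" where
  "time_scale \<rho> = {\<rho> * real n | n. True}"

definition delta :: "real \<Rightarrow> (real \<Rightarrow> real) \<Rightarrow> real \<Rightarrow> real" where
  "delta \<rho> z t = (z (t + \<rho>) - z t) / \<rho>"

definition last_time :: "real \<Rightarrow> real \<Rightarrow> real" where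
  "last_time \<rho> t = \<rho> * of_int \<lfloor>t / \<rho>\<rfloor>"

(* A function on a time scale is represented by a total function on the reals.
   For mu, nu > 0 all values of x and y that occur below are values at points of
   time_scale mu and time_scale nu respectively. *)
definition async_solution ::
  "real \<Rightarrow> real \<Rightarrow> real \<Rightarrow> real \<Rightarrow> real \<Rightarrow> real \<Rightarrow> (real \<Rightarrow> real) \<Rightarrow> (real \<Rightarrow> real) \<Rightarrow> bool" where
  "async_solution \<mu> \<nu> \<alpha> \<beta> \<gamma> \<delta> x y \<longleftrightarrow>
     (\<forall>t\<in>time_scale \<mu>. delta \<mu> x t = \<alpha> * x t + \<beta> * y (last_time \<nu> t)) \<and>
     (\<forall>t\<in>time_scale \<nu>. delta \<nu> y t = \<gamma> * x (last_time \<mu> t) + \<delta> * y t)"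

definition Psi :: "nat \<Rightarrow> real \<Rightarrow> real \<Rightarrow> real \<Rightarrow> real \<Rightarrow> real mat" where
  "Psi \<mu> \<alpha> \<beta> \<gamma> \<delta> = mat_of_rows_list 2
     [[1 + real \<mu> * \<alpha>, real \<mu> * \<beta>],
      [\<Sum>i<\<mu>. \<gamma> * (1 + \<delta>) ^ i, (1 + \<delta>) ^ \<mu>]]"

(* Limit as t tends to infinity along the points of time_scale rho. *)
definition tendsto_along :: "real \<Rightarrow> (real \<Rightarrow> real) \<Rightarrow> real \<Rightarrow> bool" where
  "tendsto_along \<rho> z l \<longleftrightarrow> (z \<longlongrightarrow> l) (inf at_top (principal (time_scale \<rho>)))"

definition zero_globally_asymptotically_stable ::
  "real \<Rightarrow> real \<Rightarrow> real \<Rightarrow> real \<Rightarrow> real \<Rightarrow> real \<Rightarrow> bool" where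
  "zero_globally_asymptotically_stable \<mu> \<nu> \<alpha> \<beta> \<gamma> \<delta> \<longleftrightarrow>
     async_solution \<mu> \<nu> \<alpha> \<beta> \<gamma> \<delta> (\<lambda>_. 0) (\<lambda>_. 0) \<and>
     (\<forall>x y. async_solution \<mu> \<nu> \<alpha> \<beta> \<gamma> \<delta> x y \<longrightarrow>
        tendsto_along \<mu> x 0 \<and> tendsto_along \<nu> y 0)"

end

theory Submission
  imports Defs "HOL-Analysis.Elementary_Normed_Spaces"
begin

text \<open>Sampling a solution at the multiples of \<open>\<mu>\<close> gives the linear recursion with matrix \<open>\<Psi>\<close>.
  By Cayley--Hamilton each sampled component satisfies a scalar second-order recursion whose
  characteristic roots are the eigenvalues of \<open>\<Psi>\<close>, so it is dominated by \<open>(D + C k) r\<^sup>k\<close> for some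
  \<open>r < 1\<close>. Between two samples \<open>y\<close> is a combination, with uniformly bounded coefficients, of the
  values at the left sample.\<close>

text \<open>Dividing by \<open>r ^ k\<close> turns the recursion into a sequence that grows by at
  most a constant per step. The resulting linear factor in \<open>k\<close> is beaten by the
  geometric one, and no case distinction on l = m is needed.\<close>

lemma linear_recurrence1_tendsto_0:
  fixes u :: "nat \<Rightarrow> 'a::real_normed_field"
  assumes "norm l < 1" "norm m < 1"
    and rec: "\<And>k. u (Suc k) = l * u k + m ^ k * v"
  shows "u \<longlonglongrightarrow> 0"
proof -
  \<comment> \<open>Strictly above both norms, so that \<open>r\<close> is positive even if l = m =
    0; the definition of \<open>C\<close> divides by it.\<close>
  obtain r where r: "max (norm l) (norm m) < r" "r < 1"
    using dense[of "max (norm l) (norm m)" 1] assms by auto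
  have r0: "0 < r" using r(1) norm_ge_zero[of l] by linarith
  \<comment> \<open>The forcing contributes at most \<open>r ^ k * norm v = C * r ^ Suc k\<close>,
    exactly the growth of the linear term from \<open>k\<close> to \<open>Suc k\<close>.\<close>
  define C where "C = norm v / r"
  have bound: "norm (u k) \<le> (norm (u 0) + C * real k) * r ^ k" for k
  proof (induction k)
    case (Suc k)
    have "norm (u (Suc k)) \<le> norm l * norm (u k) + norm m ^ k * norm v"
      unfolding rec by (metis norm_mult norm_power norm_triangle_ineq)
    also have "\<dots> \<le> r * ((norm (u 0) + C * real k) * r ^ k) + r ^ k * norm v"
      using r r0 Suc by (intro add_mono mult_mono power_mono) auto
    also have "\<dots> = (norm (u 0) + C * real (Suc k)) * r ^ Suc k"
      using r0 by (simp add: C_def field_simps)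
    finally show ?case .
  qed simp
  have "(\<lambda>k. norm (u 0) * r ^ k + C * (real k * r ^ k)) \<longlonglongrightarrow> norm (u 0) * 0 + C * 0"
    using r r0 powser_times_n_limit_0[of r]
    by (intro tendsto_intros LIMSEQ_power_zero) auto
  moreover have "norm (u k) \<le> norm (u 0) * r ^ k + C * (real k * r ^ k)" for k
    using bound[of k] by (simp add: algebra_simps)
  ultimately show ?thesis
    by (intro Lim_null_comparison[of u]) auto
qed

text \<open>With E the shift, the recursion reads (E - l)(E - m) u = 0. Hence
  \<open>u (Suc k) - l * u k\<close> is geometric with ratio \<open>m\<close>, which leaves a
  first-order recursion with geometric forcing.\<close>

lemma linear_recurrence2_tendsto_0:
  fixes u :: "nat \<Rightarrow> 'a::real_normed_field"
  assumes "norm l < 1" "norm m < 1"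
    and rec: "\<And>k. u (Suc (Suc k)) = (l + m) * u (Suc k) - l * m * u k"
  shows "u \<longlonglongrightarrow> 0"
proof -
  have "u (Suc k) = l * u k + m ^ k * (u 1 - l * u 0)" for k
  proof (induction k)
    case (Suc k)
    have "u (Suc (Suc k)) = l * u (Suc k) + m * (u (Suc k) - l * u k)"
      by (simp add: rec algebra_simps)
    also have "u (Suc k) - l * u k = m ^ k * (u 1 - l * u 0)"
      using Suc by simp
    finally show ?case by (simp add: mult_ac)
  qed simp
  then show ?thesis
    using assms linear_recurrence1_tendsto_0 by blast
qed

text \<open>The two numbers are the roots of z^2 - s z + p, given by the quadratic formula; a double
  root is allowed.\<close>

lemma ex_complex_sum_prod:
  obtains l m :: complex where "l + m = s" "l * m = p"
proof -
  define d where "d = csqrt (s\<^sup>2 - 4 * p)"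
  have "d\<^sup>2 = s\<^sup>2 - 4 * p" by (simp add: d_def)
  then have "(s + d) / 2 * ((s - d) / 2) = p"
    by (simp add: algebra_simps power2_eq_square)
  moreover have "(s + d) / 2 + (s - d) / 2 = s" by (simp add: field_simps)
  ultimately show thesis using that by blast
qed

lemma det_mat_2:
  fixes A :: "'a::comm_ring_1 mat"
  assumes A: "A \<in> carrier_mat 2 2"
  shows "det A = A $$ (0,0) * A $$ (1,1) - A $$ (0,1) * A $$ (1,0)"
proof -
  have minor: "det (mat_delete A i 0) = mat_delete A i 0 $$ (0,0)" for i
    using mat_delete_carrier[OF A] by (intro det_single) simp
  have "mat_delete A 0 0 $$ (0,0) = A $$ (1,1)" "mat_delete A 1 0 $$ (0,0) = A $$ (0,1)"
    using A by (simp_all add: mat_delete_def)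
  moreover have "det A = A $$ (0,0) * cofactor A 0 0 + A $$ (1,0) * cofactor A 1 0"
    unfolding laplace_expansion_column[OF A zero_less_numeral] by (simp add: numeral_2_eq_2)
  ultimately show ?thesis
    by (simp add: cofactor_def minor mult.commute)
qed

lemma eigenvalue_mat_2:
  fixes A :: "'a::field mat"
  assumes A: "A \<in> carrier_mat 2 2"
    and "(A $$ (0,0) - z) * (A $$ (1,1) - z) = A $$ (0,1) * A $$ (1,0)"
  shows "eigenvalue A z"
proof -
  have "det (char_matrix A z) = (A $$ (0,0) - z) * (A $$ (1,1) - z) - A $$ (0,1) * A $$ (1,0)"
    using A by (subst det_mat_2) (simp_all add: char_matrix_def)
  also have "\<dots> = 0" using assms(2) by simp
  finally have "det (char_matrix A z) = 0" .
  then show ?thesis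
    using eigenvalue_det[OF A] by simp
qed

lemma mat_2_recurrence_tendsto_0:
  fixes u v :: "nat \<Rightarrow> complex"
  assumes A: "A \<in> carrier_mat 2 2" and spec: "spectrum A \<subseteq> ball 0 1"
    and u: "\<And>k. u (Suc k) = A $$ (0,0) * u k + A $$ (0,1) * v k"
    and v: "\<And>k. v (Suc k) = A $$ (1,0) * u k + A $$ (1,1) * v k"
  shows "u \<longlonglongrightarrow> 0" "v \<longlonglongrightarrow> 0"
proof -
  obtain l m where sum: "l + m = A $$ (0,0) + A $$ (1,1)"
    and prod: "l * m = A $$ (0,0) * A $$ (1,1) - A $$ (0,1) * A $$ (1,0)"
    using ex_complex_sum_prod .
  \<comment> \<open>By their sum (the trace) and product (the determinant), \<open>l\<close> and
    \<open>m\<close> are the roots of the characteristic polynomial, hence eigenvalues of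
    \<open>A\<close>.\<close>
  have norm: "norm z < 1" if "z = l \<or> z = m" for z
  proof -
    have "(A $$ (0,0) - z) * (A $$ (1,1) - z) - A $$ (0,1) * A $$ (1,0)
        = l * m - (l + m) * z + z * z"
      unfolding sum prod by (simp add: algebra_simps)
    also have "\<dots> = 0" using that by (auto simp: algebra_simps)
    finally have "eigenvalue A z" by (intro eigenvalue_mat_2[OF A]) simp
    then show ?thesis using spec by (auto simp: spectrum_def)
  qed
  \<comment> \<open>Expanding two steps of \<open>u\<close> and \<open>v\<close> reduces the
    second-order recursion to a polynomial identity in the entries of \<open>A\<close>.\<close>
  show "u \<longlonglongrightarrow> 0"
    by (rule linear_recurrence2_tendsto_0[of l m])
       (use norm in \<open>simp_all add: sum prod u v algebra_simps\<close>)
  show "v \<longlonglongrightarrow> 0"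
    by (rule linear_recurrence2_tendsto_0[of l m])
       (use norm in \<open>simp_all add: sum prod u v algebra_simps\<close>)
qed

lemma tendsto_along_time_scale:
  assumes "0 < \<rho>"
    and lim: "(\<lambda>n. z (\<rho> * real n)) \<longlonglongrightarrow> c"
  shows "tendsto_along \<rho> z c"
  unfolding tendsto_along_def
proof (rule tendstoI)
  fix e :: real assume "e > 0"
  then obtain N where N: "\<And>n. n \<ge> N \<Longrightarrow> dist (z (\<rho> * real n)) c < e"
    using lim unfolding lim_sequentially by blast
  have "dist (z t) c < e" if "t \<ge> \<rho> * real N" "t \<in> time_scale \<rho>" for t
    using that N assms(1) by (auto simp: time_scale_def)
  then show "\<forall>\<^sub>F t in inf at_top (principal (time_scale \<rho>)). dist (z t) c < e"
    unfolding eventually_inf_principal eventually_at_top_linorder by blast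
qed

lemma last_time_1_of_nat [simp]: "last_time 1 (real n) = real n"
  by (simp add: last_time_def)

text \<open>The floor of k + j/\<mu> is k. So \<open>x\<close> stays frozen at the left sample for a
  whole block; at j = \<mu> the next sample would already be read.\<close>

lemma last_time_of_nat:
  "j < \<mu> \<Longrightarrow> last_time (real \<mu>) (real (\<mu> * k + j)) = real (\<mu> * k)"
  by (simp add: last_time_def floor_divide_of_nat_eq del: of_nat_add of_nat_mult) simp

lemma async_solution_zero: "async_solution \<mu> \<nu> \<alpha> \<beta> \<gamma> \<delta> (\<lambda>_. 0) (\<lambda>_. 0)"
  by (simp add: async_solution_def delta_def)

context
  fixes \<mu> :: nat and \<alpha> \<beta> \<gamma> \<delta> :: real and x y :: "real \<Rightarrow> real"
  assumes mu: "\<mu> \<ge> 1"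
    and sol: "async_solution (real \<mu>) 1 \<alpha> \<beta> \<gamma> \<delta> x y"
begin

lemma x_step:
  "x (real (\<mu> * Suc k)) = (1 + real \<mu> * \<alpha>) * x (real (\<mu> * k)) + real \<mu> * \<beta> * y (real (\<mu> * k))"
proof -
  have "real (\<mu> * k) \<in> time_scale (real \<mu>)" by (auto simp: time_scale_def)
  then have "delta (real \<mu>) x (real (\<mu> * k)) = \<alpha> * x (real (\<mu> * k)) + \<beta> * y (real (\<mu> * k))"
    \<comment> \<open>As \<mu> is an integer, the sample time is itself a point of
      \<open>time_scale 1\<close>, so \<open>y\<close> is read there without delay.\<close>
    using sol last_time_1_of_nat[of "\<mu> * k"] unfolding async_solution_def by metis
  moreover have "real (\<mu> * k) + real \<mu> = real (\<mu> * Suc k)" by simp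
  ultimately have "(x (real (\<mu> * Suc k)) - x (real (\<mu> * k))) / real \<mu>
      = \<alpha> * x (real (\<mu> * k)) + \<beta> * y (real (\<mu> * k))"
    unfolding delta_def by metis
  then show ?thesis using mu by (simp add: divide_eq_eq algebra_simps del: of_nat_mult mult_Suc_right)
qed

lemma y_step:
  assumes "j < \<mu>"
  shows "y (real (\<mu> * k + Suc j)) = \<gamma> * x (real (\<mu> * k)) + (1 + \<delta>) * y (real (\<mu> * k + j))"
proof -
  have "real (\<mu> * k + j) \<in> time_scale 1" by (auto simp: time_scale_def simp del: of_nat_add of_nat_mult)
  then have "delta 1 y (real (\<mu> * k + j)) = \<gamma> * x (real (\<mu> * k)) + \<delta> * y (real (\<mu> * k + j))"
    using sol last_time_of_nat[OF assms, of k] unfolding async_solution_def by metis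
  moreover have "real (\<mu> * k + j) + 1 = real (\<mu> * k + Suc j)" by simp
  ultimately have "y (real (\<mu> * k + Suc j)) - y (real (\<mu> * k + j))
      = \<gamma> * x (real (\<mu> * k)) + \<delta> * y (real (\<mu> * k + j))"
    unfolding delta_def by (metis div_by_1)
  then show ?thesis by (simp add: algebra_simps)
qed

text \<open>Within a block, \<open>y\<close> obeys an affine recursion with ratio 1 + \<delta> and
  constant forcing. The endpoint j = \<mu> is included because it yields the second row of
  \<open>Psi\<close>.\<close>

lemma y_between:
  "j \<le> \<mu> \<Longrightarrow> y (real (\<mu> * k + j)) =
     (\<Sum>i<j. \<gamma> * (1 + \<delta>) ^ i) * x (real (\<mu> * k)) + (1 + \<delta>) ^ j * y (real (\<mu> * k))"
proof (induction j)
  case (Suc j)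
  \<comment> \<open>The term i = 0 is split off rather than the last one: \<open>y_step\<close>
    multiplies the old sum by 1 + \<delta> and adds a fresh \<gamma>.\<close>
  have geo: "(\<Sum>i<Suc j. \<gamma> * (1 + \<delta>) ^ i) = \<gamma> + (1 + \<delta>) * (\<Sum>i<j. \<gamma> * (1 + \<delta>) ^ i)"
    unfolding sum.lessThan_Suc_shift by (simp add: sum_distrib_left mult_ac)
  from Suc have "y (real (\<mu> * k + Suc j)) = \<gamma> * x (real (\<mu> * k)) + (1 + \<delta>) *
      ((\<Sum>i<j. \<gamma> * (1 + \<delta>) ^ i) * x (real (\<mu> * k)) + (1 + \<delta>) ^ j * y (real (\<mu> * k)))"
    using y_step[of j k] by simp
  then show ?case unfolding geo power_Suc by (simp only: algebra_simps)
qed simp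

lemma samples_tendsto_0:
  assumes spec: "spectrum (map_mat complex_of_real (Psi \<mu> \<alpha> \<beta> \<gamma> \<delta>)) \<subseteq> ball 0 1"
  shows "(\<lambda>k. x (real (\<mu> * k))) \<longlonglongrightarrow> 0" "(\<lambda>k. y (real (\<mu> * k))) \<longlonglongrightarrow> 0"
proof -
  let ?A = "map_mat complex_of_real (Psi \<mu> \<alpha> \<beta> \<gamma> \<delta>)"
  have A: "?A \<in> carrier_mat 2 2"
    by (rule carrier_matI) (simp_all add: Psi_def mat_of_rows_list_def)
  have entries: "?A $$ (0,0) = of_real (1 + real \<mu> * \<alpha>)" "?A $$ (0,1) = of_real (real \<mu> * \<beta>)"
    "?A $$ (1,0) = of_real (\<Sum>i<\<mu>. \<gamma> * (1 + \<delta>) ^ i)" "?A $$ (1,1) = of_real ((1 + \<delta>) ^ \<mu>)"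
    by (simp_all add: Psi_def mat_of_rows_list_def)
  have y_next: "y (real (\<mu> * Suc k)) =
      (\<Sum>i<\<mu>. \<gamma> * (1 + \<delta>) ^ i) * x (real (\<mu> * k)) + (1 + \<delta>) ^ \<mu> * y (real (\<mu> * k))" for k
    using y_between[of \<mu> k] by (simp add: add.commute)
  \<comment> \<open>The samples are embedded in the complex numbers because the eigenvalues of the
    real matrix \<open>Psi\<close> need not be real.\<close>
  let ?x = "\<lambda>k. complex_of_real (x (real (\<mu> * k)))"
  let ?y = "\<lambda>k. complex_of_real (y (real (\<mu> * k)))"
  have x_rec: "?x (Suc k) = ?A $$ (0,0) * ?x k + ?A $$ (0,1) * ?y k" for k
    by (simp only: entries x_step of_real_mult of_real_add)
  have y_rec: "?y (Suc k) = ?A $$ (1,0) * ?x k + ?A $$ (1,1) * ?y k" for k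
    by (simp only: entries y_next of_real_mult of_real_add)
  have "?x \<longlonglongrightarrow> 0" "?y \<longlonglongrightarrow> 0"
    using mat_2_recurrence_tendsto_0[of _ ?x ?y, OF A spec x_rec y_rec] by blast+
  then show "(\<lambda>k. x (real (\<mu> * k))) \<longlonglongrightarrow> 0" "(\<lambda>k. y (real (\<mu> * k))) \<longlonglongrightarrow> 0"
    using tendsto_of_real_iff[where 'a = complex and c = 0] by auto
qed

lemma y_tendsto_0:
  assumes xlim: "(\<lambda>k. x (real (\<mu> * k))) \<longlonglongrightarrow> 0" and ylim: "(\<lambda>k. y (real (\<mu> * k))) \<longlonglongrightarrow> 0"
  shows "(\<lambda>n. y (real n)) \<longlonglongrightarrow> 0"
proof -
  \<comment> \<open>Only finitely many offsets \<open>j\<close> occur, so the sum of these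
    nonnegative quantities bounds the coefficients of \<open>y_between\<close> uniformly.\<close>
  define M where "M = (\<Sum>j<\<mu>. \<bar>\<Sum>i<j. \<gamma> * (1 + \<delta>) ^ i\<bar> + \<bar>(1 + \<delta>) ^ j\<bar>)"
  have M: "\<bar>\<Sum>i<j. \<gamma> * (1 + \<delta>) ^ i\<bar> + \<bar>(1 + \<delta>) ^ j\<bar> \<le> M" if "j < \<mu>" for j
    unfolding M_def by (rule member_le_sum) (use that in auto)
  let ?b = "\<lambda>k. M * (\<bar>x (real (\<mu> * k))\<bar> + \<bar>y (real (\<mu> * k))\<bar>)"
  have bound: "norm (y (real n)) \<le> ?b (n div \<mu>)" for n
  proof -
    define j k where "j = n mod \<mu>" and "k = n div \<mu>"
    have n: "n = \<mu> * k + j" and j: "j < \<mu>" using mu by (simp_all add: j_def k_def)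
    have "norm (y (real n)) \<le> \<bar>\<Sum>i<j. \<gamma> * (1 + \<delta>) ^ i\<bar> * \<bar>x (real (\<mu> * k))\<bar>
        + \<bar>(1 + \<delta>) ^ j\<bar> * \<bar>y (real (\<mu> * k))\<bar>"
      unfolding n y_between[OF less_imp_le[OF j]] real_norm_def abs_mult[symmetric]
      by (rule abs_triangle_ineq)
    also have "\<dots> \<le> M * \<bar>x (real (\<mu> * k))\<bar> + M * \<bar>y (real (\<mu> * k))\<bar>"
      using M[OF j] by (intro add_mono mult_right_mono) linarith+
    finally show ?thesis by (simp add: k_def distrib_left)
  qed
  have "?b \<longlonglongrightarrow> M * (\<bar>0\<bar> + \<bar>0\<bar>)"
    by (intro tendsto_intros xlim ylim)
  \<comment> \<open>The bound on \<open>y (real n)\<close> depends only on the block index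
    \<open>n div \<mu>\<close>, which tends to infinity with \<open>n\<close>.\<close>
  moreover have "filterlim (\<lambda>n. n div \<mu>) at_top sequentially"
    unfolding filterlim_at_top
  proof
    fix Z
    show "\<forall>\<^sub>F n in sequentially. Z \<le> n div \<mu>"
      using eventually_ge_at_top[of "Z * \<mu>"]
      by eventually_elim (use mu in \<open>simp add: less_eq_div_iff_mult_less_eq\<close>)
  qed
  ultimately have "(\<lambda>n. ?b (n div \<mu>)) \<longlonglongrightarrow> M * (\<bar>0\<bar> + \<bar>0\<bar>)"
    by (rule filterlim_compose)
  then have "(\<lambda>n. ?b (n div \<mu>)) \<longlonglongrightarrow> 0" by (simp only: abs_zero add_0 mult_zero_right)
  then show ?thesis
    by (rule Lim_null_comparison[OF always_eventually[OF allI[OF bound]]])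
qed

end

theorem theorem6p1:
  fixes \<mu> :: nat and \<alpha> \<beta> \<gamma> \<delta> :: real
  assumes "\<mu> \<ge> 1"
    and "spectrum (map_mat complex_of_real (Psi \<mu> \<alpha> \<beta> \<gamma> \<delta>)) \<subseteq> ball 0 1"
  shows "zero_globally_asymptotically_stable (real \<mu>) 1 \<alpha> \<beta> \<gamma> \<delta>"
  unfolding zero_globally_asymptotically_stable_def
proof (intro conjI allI impI)
  show "async_solution (real \<mu>) 1 \<alpha> \<beta> \<gamma> \<delta> (\<lambda>_. 0) (\<lambda>_. 0)"
    by (rule async_solution_zero)
next
  fix x y assume sol: "async_solution (real \<mu>) 1 \<alpha> \<beta> \<gamma> \<delta> x y"
  note lim = samples_tendsto_0[OF assms(1) sol assms(2)]
  show "tendsto_along (real \<mu>) x 0"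
    using assms(1) lim(1) by (intro tendsto_along_time_scale) simp_all
  show "tendsto_along 1 y 0"
    using y_tendsto_0[OF assms(1) sol lim] by (intro tendsto_along_time_scale) simp_all
qed

end
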